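(* A numerical semigroup is representable if and only if it is a quotient of a flat semigroup; that is, a numerical semigroup $\mathcal{S}$ is representable if and only if there exist a flat numerical semigroup $\mathcal{F}$ and an integer $k\geq 1$ such that $\mathcal{S}=\mathcal{F}/k$.
   Context: A numerical semigroup is a submonoid of $\mathbb{N}=\{0,1,2,\dots\}$ with finite complement; $G(a_1,\dots,a_n)$ denotes the submonoid generated by $a_1,\dots,a_n$. For a submonoid $\mathcal{F}\subset\mathbb{N}$ and an integer $k\geq 1$, the quotient is $\mathcal{F}/k:=\{\ell\in\mathbb{N}: k\ell\in\mathcal{F}\}$. Representable semigroups. For a normal weighted homogeneous surface singularity $(X,0)$ (germ at the origin of an affine surface with good effective $\mathbb{C}^*$-action, so that its coordinate ring is graded, $R_X=\bigoplus_{\ell\geq 0}R_{X,\ell}$) whose link is a rational homology sphere, put $\mathcal{S}_{(X,0)}=\{\ell\geq 0: R_{X,\ell}\neq 0\}$. A numerical semigroup is representable if it equals some such $\mathcal{S}_{(X,0)}$. By Pinkham this is equivalent to the following combinatorial description. An SSR graph $\Gamma$ is a negative definite star-shaped plumbing graph with all genera zero, determined by normalized Seifert invariants $Sf=(-b_0;(\alpha_i,\omega_i)_{i=1}^d)$, where $b_0\in\mathbb{Z}_{>0}$, $d\geq 3$, $0<\omega_i<\alpha_i$, $\gcd(\alpha_i,\omega_i)=1$, and $e:=-b_0+\sum_{i=1}^d\omega_i/\alpha_i<0$ (negative definiteness). Its quasi-linear function is $N(\ell)=b_0\ell-\sum_{i=1}^d\lceil \ell\omega_i/\alpha_i\rceil$,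 and $\mathcal{S}_\Gamma=\{\ell\in\mathbb{Z}: N(\ell)\geq 0\}$ (contained in $\mathbb{N}$). A numerical semigroup is representable iff it equals $\mathcal{S}_\Gamma$ for some SSR graph $\Gamma$. Flat semigroups. For $A=\{a_1,\dots,a_n\}$ with $\gcd(a_1,\dots,a_n)=1$, put $q_i:=\gcd(a_j: j\neq i)$, $\widehat{q}_i:=\prod_{j\neq i}q_j$ and $\widehat{s}_i:=a_i/\widehat{q}_i$ (an integer, since the $q_i$ are pairwise relatively prime). $A$ is flat if $\widehat{s}_i=1$ for some $i$. A numerical semigroup is flat if its minimal set of generators is flat. The semigroup $\mathbb{N}$ is regarded as flat. *)

theory Defs
  imports Complex_Main "HOL.Hull"
begin

definition submonoid_nat :: "nat set \<Rightarrow> bool" where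
  "submonoid_nat S \<longleftrightarrow> 0 \<in> S \<and> (\<forall>x\<in>S. \<forall>y\<in>S. x + y \<in> S)"

definition numerical_semigroup :: "nat set \<Rightarrow> bool" where
  "numerical_semigroup S \<longleftrightarrow> submonoid_nat S \<and> finite (- S)"

definition generated_submonoid :: "nat set \<Rightarrow> nat set" where
  "generated_submonoid A = submonoid_nat hull A"

definition minimal_generators :: "nat set \<Rightarrow> nat set \<Rightarrow> bool" where
  "minimal_generators A S \<longleftrightarrow>
     generated_submonoid A = S \<and> (\<forall>B. B \<subset> A \<longrightarrow> generated_submonoid B \<noteq> S)"

definition semigroup_quotient :: "nat set \<Rightarrow> nat \<Rightarrow> nat set" where
  "semigroup_quotient F k = {l. k * l \<in> F}"


subsection \<open>Flat semigroups\<close>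

text \<open>
  The generators are indexed by themselves: for \<open>a = a\<^sub>i\<close> in \<open>A = {a\<^sub>1, \<dots>, a\<^sub>n}\<close>, the
  numbers \<open>q A a\<close>, \<open>q_hat A a\<close> and \<open>s_hat A a\<close> stand for the quantities with index \<open>i\<close>.
  If \<open>Gcd A = 1\<close> then the \<open>q A b\<close> are pairwise coprime and, for \<open>b \<noteq> a\<close>, divide \<open>a\<close>,
  so the division in \<open>s_hat\<close> is exact.
\<close>

definition q :: "nat set \<Rightarrow> nat \<Rightarrow> nat" where
  "q A a = Gcd (A - {a})"

definition q_hat :: "nat set \<Rightarrow> nat \<Rightarrow> nat" where
  "q_hat A a = (\<Prod>b\<in>A - {a}. q A b)"

definition s_hat :: "nat set \<Rightarrow> nat \<Rightarrow> nat" where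
  "s_hat A a = a div q_hat A a"

definition flat_set :: "nat set \<Rightarrow> bool" where
  "flat_set A \<longleftrightarrow> finite A \<and> Gcd A = 1 \<and> (\<exists>a\<in>A. s_hat A a = 1)"

definition flat_semigroup :: "nat set \<Rightarrow> bool" where
  "flat_semigroup F \<longleftrightarrow> numerical_semigroup F \<and>
     (F = UNIV \<or> (\<exists>A. minimal_generators A F \<and> flat_set A))"


subsection \<open>Representable semigroups\<close>

text \<open>
  An SSR graph (a negative definite star-shaped plumbing graph with all genera zero) is given
  by its normalized Seifert invariants \<open>(-b\<^sub>0; (\<alpha>\<^sub>i, \<omega>\<^sub>i)\<^sub>i)\<close>: here \<open>minus_central\<close> is \<open>b\<^sub>0\<close>,
  the negative of the Euler decoration of the central vertex, and \<open>legs\<close> is the list of the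
  pairs \<open>(\<alpha>\<^sub>i, \<omega>\<^sub>i)\<close>. The graph is negative definite iff its orbifold Euler number is negative.
  By Pinkham's theorem, the semigroups \<open>ssr_semigroup \<Gamma>\<close> are exactly the semigroups of degrees
  of nonzero homogeneous functions on normal weighted homogeneous surface singularities whose
  link is a rational homology sphere.
\<close>

datatype seifert = Seifert (minus_central: int) (legs: "(int \<times> int) list")

definition euler_number :: "seifert \<Rightarrow> rat" where
  "euler_number \<Gamma> =
     - of_int (minus_central \<Gamma>) + (\<Sum>(\<alpha>, \<omega>)\<leftarrow>legs \<Gamma>. of_int \<omega> / of_int \<alpha>)"

definition ssr_graph :: "seifert \<Rightarrow> bool" where
  "ssr_graph \<Gamma> \<longleftrightarrow>
     minus_central \<Gamma> > 0 \<and> length (legs \<Gamma>) \<ge> 3 \<and>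
     (\<forall>(\<alpha>, \<omega>)\<in>set (legs \<Gamma>). 0 < \<omega> \<and> \<omega> < \<alpha> \<and> coprime \<alpha> \<omega>) \<and>
     euler_number \<Gamma> < 0"

definition quasi_linear :: "seifert \<Rightarrow> int \<Rightarrow> int" where
  "quasi_linear \<Gamma> l =
     minus_central \<Gamma> * l - (\<Sum>(\<alpha>, \<omega>)\<leftarrow>legs \<Gamma>. \<lceil>of_int (l * \<omega>) / (of_int \<alpha> :: rat)\<rceil>)"

definition ssr_semigroup :: "seifert \<Rightarrow> int set" where
  "ssr_semigroup \<Gamma> = {l. quasi_linear \<Gamma> l \<ge> 0}"

definition representable :: "nat set \<Rightarrow> bool" where
  "representable S \<longleftrightarrow>
     numerical_semigroup S \<and> (\<exists>\<Gamma>. ssr_graph \<Gamma> \<and> int ` S = ssr_semigroup \<Gamma>)"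

end

theory Submission imports Defs "HOL-Number_Theory.Cong" begin

text \<open>
  Let \<open>p\<^sub>i\<close> be pairwise coprime with product \<open>P\<close>, and let every \<open>a\<^sub>i\<close> be coprime to \<open>p\<^sub>i\<close> and
  divisible by the other \<open>p\<^sub>j\<close>; flat semigroups are those generated by such \<open>P\<close> and \<open>a\<^sub>i\<close>.
  The coefficient of \<open>a\<^sub>i\<close> in a representation of \<open>l\<close> is determined modulo \<open>p\<^sub>i\<close>, so \<open>l\<close> is in
  the semigroup iff the sum of the \<open>a\<^sub>i (l a\<^sub>i\<^sup>-\<^sup>1 mod p\<^sub>i)\<close> is at most \<open>l\<close>. Replaced by \<open>k l\<close>, this is
  the condition \<open>N(l) \<ge> 0\<close> for the Seifert data with \<open>a\<^sub>i p\<^sub>i / P\<close> legs of type \<open>(p\<^sub>i, - k a\<^sub>i\<^sup>-\<^sup>1)\<close>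
  and \<open>e = - k / P\<close>. These data need not be normalized, but normalizing and then tripling them
  yields an SSR graph with the same semigroup.

  Conversely, since the ceiling is left continuous, lowering the slopes \<open>\<omega>\<^sub>i / \<alpha>\<^sub>i\<close> slightly does
  not change \<open>N(l)\<close> for small \<open>l \<ge> 0\<close>, and \<open>N(l) \<ge> 0\<close> for large \<open>l\<close> before and after. So the
  \<open>\<alpha>\<^sub>i\<close> may be taken to be distinct primes \<open>p\<^sub>i\<close>. Then \<open>k = - e P\<close> is a positive integer, and the
  semigroup is the quotient by \<open>k\<close> of the flat semigroup generated by the \<open>P / p\<^sub>i\<close>.
\<close>

section \<open>Preliminaries\<close>

lemma prod_dvd_of_pairwise_coprime:
  fixes p :: "'i \<Rightarrow> 'a :: semiring_gcd"
  assumes "finite I"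
    and "\<And>i j. i \<in> I \<Longrightarrow> j \<in> I \<Longrightarrow> i \<noteq> j \<Longrightarrow> coprime (p i) (p j)"
    and "\<And>i. i \<in> I \<Longrightarrow> p i dvd m"
  shows "(\<Prod>i\<in>I. p i) dvd m"
  using assms
proof (induction I rule: finite_induct)
  case (insert x I)
  have "coprime (p x) (\<Prod>i\<in>I. p i)"
    using insert by (intro prod_coprime_right) auto
  then show ?case
    using insert by (simp add: divides_mult)
qed simp

lemma sum_list_concat_replicate:
  fixes f :: "'b \<Rightarrow> 'a :: comm_semiring_1"
  assumes "distinct xs"
  shows "(\<Sum>x\<leftarrow>concat (map (\<lambda>i. replicate (c i) (g i)) xs). f x) =
    (\<Sum>i\<in>set xs. of_nat (c i) * f (g i))"
  using assms by (induction xs) (auto simp: sum_list_replicate)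

lemma ceiling_of_int_divide:
  "\<lceil>of_int a / (of_int b :: rat)\<rceil> = - (- a div b)"
  using floor_divide_of_int_eq[of "- a" b, where ?'a = rat] by (simp add: ceiling_def)

lemma submonoid_generated_submonoid: "submonoid_nat (generated_submonoid A)"
  unfolding generated_submonoid_def by (rule hull_in) (auto simp: submonoid_nat_def)

lemma generated_submonoid_incl: "x \<in> A \<Longrightarrow> x \<in> generated_submonoid A"
  unfolding generated_submonoid_def by (rule hull_inc)

lemma generated_submonoid_minimal:
  "A \<subseteq> T \<Longrightarrow> submonoid_nat T \<Longrightarrow> generated_submonoid A \<subseteq> T"
  unfolding generated_submonoid_def by (rule hull_minimal)

lemma submonoid_nat_mult: "submonoid_nat T \<Longrightarrow> x \<in> T \<Longrightarrow> n * x \<in> T"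
  by (induction n) (auto simp: submonoid_nat_def)

lemma submonoid_nat_sum:
  "submonoid_nat T \<Longrightarrow> (\<And>i. i \<in> I \<Longrightarrow> f i \<in> T) \<Longrightarrow> (\<Sum>i\<in>I. f i) \<in> T"
  by (induction I rule: infinite_finite_induct) (auto simp: submonoid_nat_def)

lemma generated_submonoid_insert:
  assumes "x \<in> generated_submonoid A"
  shows "generated_submonoid (insert x A) = generated_submonoid A"
proof
  show "generated_submonoid (insert x A) \<subseteq> generated_submonoid A"
    using assms generated_submonoid_incl submonoid_generated_submonoid
    by (intro generated_submonoid_minimal) auto
  show "generated_submonoid A \<subseteq> generated_submonoid (insert x A)"
    unfolding generated_submonoid_def by (rule hull_mono) auto
qed

section \<open>Semigroups generated by a coprime system\<close>

locale coprime_system =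
  fixes I :: "'i set" and p a u :: "'i \<Rightarrow> nat"
  assumes finite_I: "finite I"
    and coprime_p: "i \<in> I \<Longrightarrow> j \<in> I \<Longrightarrow> i \<noteq> j \<Longrightarrow> coprime (p i) (p j)"
    and p_dvd_a: "i \<in> I \<Longrightarrow> j \<in> I \<Longrightarrow> i \<noteq> j \<Longrightarrow> p i dvd a j"
    and a_u_cong_1: "i \<in> I \<Longrightarrow> [a i * u i = 1] (mod p i)"
    and p_pos: "i \<in> I \<Longrightarrow> p i > 0"
begin

definition P :: nat where "P = (\<Prod>i\<in>I. p i)"

lemma P_pos: "P > 0"
  unfolding P_def using p_pos by (auto intro: prod_pos)

lemma p_dvd_P: "i \<in> I \<Longrightarrow> p i dvd P"
  unfolding P_def using finite_I by blast

lemma P_dvd: "(\<And>i. i \<in> I \<Longrightarrow> int (p i) dvd m) \<Longrightarrow> int P dvd m"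
  unfolding P_def of_nat_prod using finite_I coprime_p
  by (intro prod_dvd_of_pairwise_coprime) auto

lemma sum_a_cong:
  assumes "i \<in> I"
  shows "[(\<Sum>j\<in>I. int (a j) * x j) = int (a i) * x i] (mod int (p i))"
proof -
  have "int (p i) dvd (\<Sum>j\<in>I - {i}. int (a j) * x j)"
    using assms p_dvd_a by (intro dvd_sum dvd_mult2) auto
  then have "[int (a i) * x i + (\<Sum>j\<in>I - {i}. int (a j) * x j) = int (a i) * x i + 0]
      (mod int (p i))"
    by (intro cong_add) (auto simp: cong_0_iff)
  then show ?thesis
    using assms finite_I by (simp add: sum.remove)
qed

lemma a_u_cong_1_int: "i \<in> I \<Longrightarrow> [int (a i) * int (u i) = 1] (mod int (p i))"
  using a_u_cong_1[of i] unfolding cong_int_iff[symmetric] by simp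

text \<open>Residues are subadditive in \<open>l\<close>, so the inequality defines a submonoid, and
  it contains all generators. Conversely, if the inequality holds, \<open>l\<close> minus the sum is
  a nonnegative multiple of \<open>P\<close>, which completes a representation of
  \<open>l\<close>.\<close>

lemma mem_generated_iff:
  "l \<in> generated_submonoid (insert P (a ` I)) \<longleftrightarrow>
    (\<Sum>i\<in>I. a i * ((l * u i) mod p i)) \<le> l"
proof
  define T where "T = {l. (\<Sum>i\<in>I. a i * ((l * u i) mod p i)) \<le> l}"
  have T_add: "x + y \<in> T" if "x \<in> T" "y \<in> T" for x y
  proof -
    have "(\<Sum>i\<in>I. a i * (((x + y) * u i) mod p i)) \<le>
        (\<Sum>i\<in>I. a i * ((x * u i) mod p i) + a i * ((y * u i) mod p i))"
    proof (rule sum_mono)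
      fix i
      have "((x + y) * u i) mod p i \<le> (x * u i) mod p i + (y * u i) mod p i"
        by (metis distrib_right mod_add_eq mod_less_eq_dividend)
      then show "a i * (((x + y) * u i) mod p i) \<le>
          a i * ((x * u i) mod p i) + a i * ((y * u i) mod p i)"
        by (metis distrib_left mult_le_mono2)
    qed
    then show ?thesis
      using that unfolding T_def by (simp add: sum.distrib)
  qed
  have "P \<in> T"
    using p_dvd_P by (simp add: T_def)
  moreover have "a j \<in> T" if j: "j \<in> I" for j
  proof -
    have "(\<Sum>i\<in>I - {j}. a i * ((a j * u i) mod p i)) = 0"
      using j p_dvd_a by (intro sum.neutral) auto
    \<comment> \<open>The residue is 1 unless \<open>p j = 1\<close>, when it is 0.\<close>
    moreover have "(a j * u j) mod p j \<le> 1"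
      using a_u_cong_1[OF j] by (simp add: cong_def)
    ultimately have "a j * ((a j * u j) mod p j) + (\<Sum>i\<in>I - {j}. a i * ((a j * u i) mod p i)) \<le> a j"
      by (metis add_0_right mult.right_neutral mult_le_mono2)
    then show ?thesis
      using sum.remove[OF finite_I j, of "\<lambda>i. a i * ((a j * u i) mod p i)"] by (simp add: T_def)
  qed
  ultimately have "generated_submonoid (insert P (a ` I)) \<subseteq> T"
    using T_add by (intro generated_submonoid_minimal) (auto simp: submonoid_nat_def T_def)
  then show "(\<Sum>i\<in>I. a i * ((l * u i) mod p i)) \<le> l"
    if "l \<in> generated_submonoid (insert P (a ` I))"
    using that by (auto simp: T_def)
next
  let ?G = "generated_submonoid (insert P (a ` I))"
  let ?s = "\<Sum>i\<in>I. a i * ((l * u i) mod p i)"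
  assume le: "?s \<le> l"
  \<comment> \<open>Modulo \<open>p i\<close> only the summand with index \<open>i\<close> survives,
    and it is congruent to \<open>l\<close> because \<open>u i\<close> inverts
    \<open>a i\<close>.\<close>
  have "int P dvd int l - int ?s"
  proof (rule P_dvd)
    fix i assume i: "i \<in> I"
    have "[int ?s = int (a i) * int ((l * u i) mod p i)] (mod int (p i))"
      using sum_a_cong[OF i, of "\<lambda>j. int ((l * u j) mod p j)"] by simp
    also have "[int (a i) * int ((l * u i) mod p i) = int (a i) * int (l * u i)] (mod int (p i))"
      by (intro cong_mult) (auto simp: zmod_int)
    also have "int (a i) * int (l * u i) = int l * (int (a i) * int (u i))"
      by simp
    also have "[\<dots> = int l * 1] (mod int (p i))"
      using a_u_cong_1_int[OF i] by (intro cong_mult) auto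
    finally show "int (p i) dvd int l - int ?s"
      by (simp add: cong_iff_dvd_diff dvd_diff_commute)
  qed
  then have "P dvd l - ?s"
    using le by (metis int_dvd_int_iff of_nat_diff)
  then obtain t where "l - ?s = t * P"
    by (metis dvdE mult.commute)
  then have l: "l = ?s + t * P"
    using le by simp
  have "a i * ((l * u i) mod p i) \<in> ?G" if "i \<in> I" for i
    using that submonoid_nat_mult[OF submonoid_generated_submonoid]
    by (metis generated_submonoid_incl image_eqI insertCI mult.commute)
  moreover have "t * P \<in> ?G"
    by (simp add: submonoid_nat_mult generated_submonoid_incl submonoid_generated_submonoid)
  ultimately show "l \<in> ?G"
    using submonoid_generated_submonoid[of "insert P (a ` I)"] submonoid_nat_sum[of ?G I]
    by (subst l) (simp add: submonoid_nat_def)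
qed

text \<open>The sum in the membership criterion is bounded independently of
  \<open>l\<close>.\<close>

lemma finite_compl_generated: "finite (- generated_submonoid (insert P (a ` I)))"
proof (rule finite_subset)
  show "- generated_submonoid (insert P (a ` I)) \<subseteq> {..<(\<Sum>i\<in>I. a i * p i)}"
  proof
    fix l assume "l \<in> - generated_submonoid (insert P (a ` I))"
    then have "l < (\<Sum>i\<in>I. a i * ((l * u i) mod p i))"
      by (simp add: mem_generated_iff)
    also have "\<dots> \<le> (\<Sum>i\<in>I. a i * p i)"
      using p_pos by (intro sum_mono mult_le_mono) (auto intro: less_imp_le)
    finally show "l \<in> {..<(\<Sum>i\<in>I. a i * p i)}"
      by simp
  qed
qed simp

text \<open>Translates between generators and Seifert data with \<open>c i\<close> legs of type
  \<open>(p i, w i)\<close>: divided by \<open>P\<close>, the hypothesis on \<open>k\<close> says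
  that their Euler number is -k/P. The sum of residues for k l then equals k l - P N(l), so the
  membership criterion turns into N(l) \<ge> 0.\<close>

lemma mult_mem_generated_iff:
  assumes k: "int k = b * int P - (\<Sum>i\<in>I. int (a i) * w i)"
    and c: "\<And>i. i \<in> I \<Longrightarrow> a i * p i = c i * P"
  shows "k * l \<in> generated_submonoid (insert P (a ` I)) \<longleftrightarrow>
    b * int l - (\<Sum>i\<in>I. int (c i) * \<lceil>of_int (int l * w i) / (of_int (int (p i)) :: rat)\<rceil>) \<ge> 0"
proof -
  have res: "int (a i * ((k * l * u i) mod p i)) =
      int P * (int (c i) * \<lceil>of_int (int l * w i) / (of_int (int (p i)) :: rat)\<rceil>)
        - int l * (int (a i) * w i)"
    if i: "i \<in> I" for i
  proof -
    \<comment> \<open>Both \<open>P\<close> and the other summands vanish modulo \<open>p i\<close>;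
      hence \<open>w i\<close> is minus \<open>k\<close> times the inverse of
      \<open>a i\<close>.\<close>
    have "[int k = 0 - int (a i) * w i] (mod int (p i))"
      unfolding k using p_dvd_P[OF i] sum_a_cong[OF i]
      by (intro cong_diff) (auto simp: cong_0_iff)
    then have "[int k * (int l * int (u i)) = (0 - int (a i) * w i) * (int l * int (u i))]
        (mod int (p i))"
      by (rule cong_mult) simp
    also have "(0 - int (a i) * w i) * (int l * int (u i)) =
        - (int l * w i) * (int (a i) * int (u i))"
      by (simp add: algebra_simps)
    also have "[\<dots> = - (int l * w i) * 1] (mod int (p i))"
      using a_u_cong_1_int[OF i] by (rule cong_scalar_left)
    finally have "int ((k * l * u i) mod p i) = (- (int l * w i)) mod int (p i)"
      by (simp add: cong_def zmod_int mult.assoc)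
    \<comment> \<open>Rounding x up to a multiple of p adds exactly the residue of -x modulo
      p.\<close>
    also have "\<dots> = int (p i) * \<lceil>of_int (int l * w i) / (of_int (int (p i)) :: rat)\<rceil> - int l * w i"
      unfolding ceiling_of_int_divide by (simp add: minus_mult_div_eq_mod[symmetric])
    finally have "int (a i * ((k * l * u i) mod p i)) =
        int (a i * p i) * \<lceil>of_int (int l * w i) / (of_int (int (p i)) :: rat)\<rceil> - int l * (int (a i) * w i)"
      by (simp only: of_nat_mult right_diff_distrib mult_ac)
    then show ?thesis
      by (simp only: c[OF i] of_nat_mult mult_ac)
  qed
  define N where "N = b * int l -
    (\<Sum>i\<in>I. int (c i) * \<lceil>of_int (int l * w i) / (of_int (int (p i)) :: rat)\<rceil>)"
  have "int (\<Sum>i\<in>I. a i * ((k * l * u i) mod p i)) =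
      (\<Sum>i\<in>I. int P * (int (c i) * \<lceil>of_int (int l * w i) / (of_int (int (p i)) :: rat)\<rceil>)
        - int l * (int (a i) * w i))"
    unfolding of_nat_sum using res by (rule sum.cong[OF refl])
  also have "\<dots> = int (k * l) - int P * N"
    by (simp add: N_def k sum_subtractf sum_distrib_left algebra_simps)
  finally have "int (\<Sum>i\<in>I. a i * ((k * l * u i) mod p i)) = int (k * l) - int P * N" .
  then have "(\<Sum>i\<in>I. a i * ((k * l * u i) mod p i)) \<le> k * l \<longleftrightarrow> int P * N \<ge> 0"
    by linarith
  also have "\<dots> \<longleftrightarrow> N \<ge> 0"
    using P_pos by (simp add: zero_le_mult_iff)
  finally show ?thesis
    unfolding mem_generated_iff N_def .
qed

end

section \<open>Quotients of flat semigroups are representable\<close>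

lemma quasi_linear_le:
  "of_int (quasi_linear \<Gamma> l) \<le> - of_int l * euler_number \<Gamma>"
proof -
  have "of_int l * (\<Sum>(\<alpha>, \<omega>)\<leftarrow>xs. of_int \<omega> / of_int \<alpha>) \<le>
      (of_int (\<Sum>(\<alpha>, \<omega>)\<leftarrow>xs. \<lceil>of_int (l * \<omega>) / (of_int \<alpha> :: rat)\<rceil>) :: rat)" for xs
  proof (induction xs)
    case (Cons x xs)
    then show ?case
      by (simp add: algebra_simps case_prod_beta add_mono)
  qed simp
  from this[of "legs \<Gamma>"] show ?thesis
    unfolding euler_number_def quasi_linear_def
    by (simp add: algebra_simps)
qed

lemma quasi_linear_ge:
  "of_int (quasi_linear \<Gamma> l) \<ge> - of_int l * euler_number \<Gamma> - of_nat (length (legs \<Gamma>))"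
proof -
  have "(\<Sum>(\<alpha>, \<omega>)\<leftarrow>xs. of_int \<lceil>of_int (l * \<omega>) / (of_int \<alpha> :: rat)\<rceil>) \<le>
      of_int l * (\<Sum>(\<alpha>, \<omega>)\<leftarrow>xs. of_int \<omega> / of_int \<alpha>) + (of_nat (length xs) :: rat)" for xs
  proof (induction xs)
    case (Cons x xs)
    have "of_int \<lceil>of_int (l * snd x) / (of_int (fst x) :: rat)\<rceil> \<le>
        of_int (l * snd x) / (of_int (fst x) :: rat) + 1"
      by (rule of_int_ceiling_le_add_one)
    with Cons show ?case
      by (simp add: algebra_simps case_prod_beta)
  qed simp
  moreover have "of_int (\<Sum>(\<alpha>, \<omega>)\<leftarrow>xs. \<lceil>of_int (l * \<omega>) / (of_int \<alpha> :: rat)\<rceil>) =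
      (\<Sum>(\<alpha>, \<omega>)\<leftarrow>xs. of_int \<lceil>of_int (l * \<omega>) / (of_int \<alpha> :: rat)\<rceil> :: rat)" for xs
    by (induction xs) auto
  ultimately show ?thesis
    unfolding euler_number_def quasi_linear_def
    by (simp add: algebra_simps)
qed

text \<open>Keeps negative integers out of the semigroup even when the Seifert data are not
  normalized.\<close>

lemma quasi_linear_neg:
  assumes "euler_number \<Gamma> < 0" "l < 0"
  shows "quasi_linear \<Gamma> l < 0"
proof -
  have "- of_int l * euler_number \<Gamma> < 0"
    using assms by (simp add: mult_neg_neg)
  then show ?thesis
    using quasi_linear_le[of \<Gamma> l] by (metis le_less_trans of_int_less_0_iff)
qed

text \<open>Moving the integer part of \<omega> / \<alpha> into the central weight, deleting legs of
  slope zero and cancelling common factors preserve both the Euler number and the quasi-linear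
  function.\<close>

lemma exists_normalized_legs:
  assumes "\<forall>(\<alpha>, \<omega>)\<in>set ls. \<alpha> > 0"
  shows "\<exists>b' ls'. (\<forall>(\<alpha>, \<omega>)\<in>set ls'. 0 < \<omega> \<and> \<omega> < \<alpha> \<and> coprime \<alpha> \<omega>) \<and>
    euler_number (Seifert b' ls') = euler_number (Seifert b ls) \<and>
    (\<forall>l. quasi_linear (Seifert b' ls') l = quasi_linear (Seifert b ls) l)"
  using assms
proof (induction ls)
  case Nil
  then show ?case
    by (intro exI[of _ b] exI[of _ "[]"]) auto
next
  case (Cons x ls)
  obtain \<alpha> \<omega> where x: "x = (\<alpha>, \<omega>)"
    by force
  have \<alpha>: "\<alpha> > 0"
    using Cons.prems x by auto
  obtain b' ls' where IH: "\<forall>(\<alpha>, \<omega>)\<in>set ls'. 0 < \<omega> \<and> \<omega> < \<alpha> \<and> coprime \<alpha> \<omega>"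
    "euler_number (Seifert b' ls') = euler_number (Seifert b ls)"
    "\<And>l. quasi_linear (Seifert b' ls') l = quasi_linear (Seifert b ls) l"
    using Cons by auto
  define n r where "n = \<omega> div \<alpha>" and "r = \<omega> mod \<alpha>"
  define g where "g = gcd \<alpha> r"
  have \<omega>: "\<omega> = n * \<alpha> + r"
    unfolding n_def r_def by simp
  have quot: "of_int (l * \<omega>) / (of_int \<alpha> :: rat) = of_int (l * r) / of_int \<alpha> + of_int (l * n)" for l
    using \<alpha> by (simp add: \<omega> field_simps)
  have ceil: "\<lceil>of_int (l * \<omega>) / (of_int \<alpha> :: rat)\<rceil> = \<lceil>of_int (l * r) / (of_int \<alpha> :: rat)\<rceil> + l * n" for l
    unfolding quot by (rule ceiling_add_of_int)
  have euler: "euler_number (Seifert b (x # ls)) = euler_number (Seifert b' ls') + of_int r / of_int \<alpha> + of_int n"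
    using IH(2) quot[of 1] by (simp add: x euler_number_def)
  have quasi: "quasi_linear (Seifert b (x # ls)) l =
      quasi_linear (Seifert b' ls') l - \<lceil>of_int (l * r) / (of_int \<alpha> :: rat)\<rceil> - l * n" for l
    using IH(3)[of l] ceil[of l] by (simp add: x quasi_linear_def del: of_int_mult)
  show ?case
  proof (cases "r = 0")
    case True
    then show ?thesis
      using IH(1) euler quasi
      by (intro exI[of _ "b' - n"] exI[of _ ls'])
        (auto simp: euler_number_def quasi_linear_def algebra_simps)
  next
    case False
    define \<alpha>' r' where "\<alpha>' = \<alpha> div g" and "r' = r div g"
    have r: "0 < r" "r < \<alpha>"
      using False pos_mod_sign[OF \<alpha>, of \<omega>] pos_mod_bound[OF \<alpha>, of \<omega>] by (auto simp: r_def)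
    have g: "g > 0" "\<alpha> = \<alpha>' * g" "r = r' * g"
      using \<alpha> by (auto simp: g_def \<alpha>'_def r'_def)
    have "coprime \<alpha>' r'"
      unfolding \<alpha>'_def r'_def g_def using \<alpha> by (intro div_gcd_coprime) auto
    moreover have "0 < r'" "r' < \<alpha>'"
      using r g by (auto simp: zero_less_mult_iff)
    moreover have "of_int (l * r) / (of_int \<alpha> :: rat) = of_int (l * r') / of_int \<alpha>'" for l
      using g by (simp add: mult.assoc[symmetric])
    moreover from this[of 1] have "of_int r / (of_int \<alpha> :: rat) = of_int r' / of_int \<alpha>'"
      by simp
    ultimately show ?thesis
      using IH(1) euler quasi
      by (intro exI[of _ "b' - n"] exI[of _ "(\<alpha>', r') # ls'"])
        (auto simp: euler_number_def quasi_linear_def algebra_simps)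
  qed
qed

text \<open>Tripling \<open>b\<^sub>0\<close> and every leg multiplies the quasi-linear function by 3, which provides
  the three legs that an SSR graph must have.\<close>

lemma exists_ssr_graph:
  assumes "\<forall>(\<alpha>, \<omega>)\<in>set ls. \<alpha> > 0" and "euler_number (Seifert b ls) < 0"
  shows "\<exists>\<Gamma>. ssr_graph \<Gamma> \<and> (\<forall>l. quasi_linear \<Gamma> l \<ge> 0 \<longleftrightarrow> quasi_linear (Seifert b ls) l \<ge> 0)"
proof -
  obtain b' ls' where norm: "\<forall>(\<alpha>, \<omega>)\<in>set ls'. 0 < \<omega> \<and> \<omega> < \<alpha> \<and> coprime \<alpha> \<omega>"
    and euler: "euler_number (Seifert b' ls') = euler_number (Seifert b ls)"
    and quasi: "\<And>l. quasi_linear (Seifert b' ls') l = quasi_linear (Seifert b ls) l"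
    using exists_normalized_legs[OF assms(1)] by blast
  \<comment> \<open>Normalized slopes are positive, so a negative Euler number forces a positive
    central weight.\<close>
  have "(\<Sum>(\<alpha>, \<omega>)\<leftarrow>ls'. of_int \<omega> / (of_int \<alpha> :: rat)) \<ge> 0"
    using norm by (intro sum_list_nonneg) auto
  then have b': "b' > 0"
    using assms(2) unfolding euler[symmetric] by (simp add: euler_number_def)
  show ?thesis
  proof (cases "ls' = []")
    case True
    \<comment> \<open>Tripling an empty list yields no legs. Here the semigroup consists of all l
      \<ge> 0, and this graph, whose quasi-linear function is three times the floor of l/2, has the
      same semigroup.\<close>
    define \<Gamma> where "\<Gamma> = Seifert 3 (replicate 3 (2, 1))"
    have "quasi_linear \<Gamma> l = 3 * (l + (- l) div 2)" for l
      unfolding \<Gamma>_def quasi_linear_def ceiling_of_int_divide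
      by (simp add: sum_list_replicate algebra_simps)
    then have "quasi_linear \<Gamma> l \<ge> 0 \<longleftrightarrow> l \<ge> 0" for l
      by presburger
    moreover have "ssr_graph \<Gamma>"
      by (simp add: \<Gamma>_def ssr_graph_def euler_number_def numeral_3_eq_3)
    moreover have "quasi_linear (Seifert b ls) l = b' * l" for l
      unfolding quasi[symmetric] by (simp add: True quasi_linear_def)
    ultimately show ?thesis
      using b' by (intro exI[of _ \<Gamma>]) (auto simp: zero_le_mult_iff)
  next
    case False
    define \<Gamma> where "\<Gamma> = Seifert (3 * b') (ls' @ ls' @ ls')"
    have "length ls' \<ge> 1"
      using False by (simp add: Suc_le_eq)
    moreover have "euler_number \<Gamma> = 3 * euler_number (Seifert b' ls')"
      by (simp add: \<Gamma>_def euler_number_def)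
    ultimately have "ssr_graph \<Gamma>"
      using norm b' assms(2) unfolding euler[symmetric] by (auto simp: ssr_graph_def \<Gamma>_def)
    moreover have "quasi_linear \<Gamma> l = 3 * quasi_linear (Seifert b ls) l" for l
      unfolding quasi[symmetric] by (simp add: \<Gamma>_def quasi_linear_def)
    ultimately show ?thesis
      by (intro exI[of _ \<Gamma>]) auto
  qed
qed

lemma (in coprime_system) generated_quotient_eq_ssr_semigroup:
  assumes "k \<ge> 1"
  shows "\<exists>\<Gamma>. ssr_graph \<Gamma> \<and>
    int ` semigroup_quotient (generated_submonoid (insert P (a ` I))) k = ssr_semigroup \<Gamma>"
proof -
  \<comment> \<open>By the Chinese remainder theorem the sum is 1 modulo \<open>P\<close>; the
    quotient \<open>b\<close>, multiplied by \<open>k\<close>, will be the central weight.\<close>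
  have "int P dvd 1 - (\<Sum>i\<in>I. int (a i) * int (u i))"
  proof (rule P_dvd)
    fix i assume i: "i \<in> I"
    have "[(\<Sum>i\<in>I. int (a i) * int (u i)) = 1] (mod int (p i))"
      using sum_a_cong[OF i] a_u_cong_1_int[OF i] by (rule cong_trans)
    then show "int (p i) dvd 1 - (\<Sum>i\<in>I. int (a i) * int (u i))"
      by (metis cong_iff_dvd_diff cong_sym)
  qed
  then obtain b where b: "1 - (\<Sum>i\<in>I. int (a i) * int (u i)) = int P * b"
    by blast
  \<comment> \<open>The quotient \<open>c i\<close> will be the number of legs of type
    \<open>(p i, w i)\<close>.\<close>
  have "P dvd a i * p i" if i: "i \<in> I" for i
  proof -
    have "(\<Prod>j\<in>I - {i}. p j) dvd a i"
      using i finite_I coprime_p p_dvd_a by (intro prod_dvd_of_pairwise_coprime) auto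
    then show ?thesis
      using i finite_I by (simp add: P_def prod.remove mult.commute)
  qed
  then have "\<forall>i\<in>I. \<exists>c. a i * p i = c * P"
    by (metis dvdE mult.commute)
  then obtain c where c: "\<And>i. i \<in> I \<Longrightarrow> a i * p i = c i * P"
    by metis
  \<comment> \<open>With these numerators, \<open>k\<close> times the equation for \<open>b\<close>
    is the hypothesis on \<open>k\<close> in \<open>mult_mem_generated_iff\<close>.\<close>
  define w where "w i = - int k * int (u i)" for i
  have k: "int k = (int k * b) * int P - (\<Sum>i\<in>I. int (a i) * w i)"
  proof -
    have "(\<Sum>i\<in>I. int (a i) * w i) = - int k * (\<Sum>i\<in>I. int (a i) * int (u i))"
      by (simp add: w_def sum_distrib_left sum_negf mult_ac)
    moreover have "int k * (1 - (\<Sum>i\<in>I. int (a i) * int (u i))) = int k * (int P * b)"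
      by (simp only: b)
    ultimately show ?thesis
      by (simp add: algebra_simps)
  qed
  obtain xs where xs: "distinct xs" "set xs = I"
    using finite_distinct_list[OF finite_I] by blast
  define ls where "ls = concat (map (\<lambda>i. replicate (c i) (int (p i), w i)) xs)"
  define \<Gamma> where "\<Gamma> = Seifert (int k * b) ls"
  have quasi: "quasi_linear \<Gamma> l = int k * b * l -
      (\<Sum>i\<in>I. int (c i) * \<lceil>of_int (l * w i) / (of_int (int (p i)) :: rat)\<rceil>)" for l
    unfolding \<Gamma>_def quasi_linear_def ls_def
    by (simp only: seifert.sel sum_list_concat_replicate[OF xs(1)] xs(2) prod.case of_nat_id
        case_prod_conv)
  have "of_nat P * euler_number \<Gamma> = - (of_nat k :: rat)"
  proof -
    have "euler_number \<Gamma> = - of_int (int k * b) +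
        (\<Sum>i\<in>I. of_nat (c i) * (of_int (w i) / of_int (int (p i))))"
      unfolding \<Gamma>_def euler_number_def ls_def
      by (simp only: seifert.sel sum_list_concat_replicate[OF xs(1)] xs(2) prod.case)
    moreover have "of_nat P * (of_nat (c i) * (of_int (w i) / of_int (int (p i)))) =
        (of_int (int (a i) * w i) :: rat)" if "i \<in> I" for i
    proof -
      have "of_nat (a i) * of_nat (p i) = (of_nat (c i) * of_nat P :: rat)"
        using c[OF that] by (metis of_nat_mult)
      then show ?thesis
        using p_pos[OF that] by (simp add: field_simps)
    qed
    ultimately have "of_nat P * euler_number \<Gamma> =
        - of_nat P * of_int (int k * b) + (\<Sum>i\<in>I. of_int (int (a i) * w i))"
      by (simp only: distrib_left sum_distrib_left minus_mult_commute cong: sum.cong)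
    also have "\<dots> = of_int (- (int k * b * int P) + (\<Sum>i\<in>I. int (a i) * w i))"
      by simp
    also have "- (int k * b * int P) + (\<Sum>i\<in>I. int (a i) * w i) = - int k"
      using k by linarith
    finally show ?thesis
      by simp
  qed
  then have euler: "euler_number \<Gamma> < 0"
    using assms P_pos by (metis of_nat_0_less_iff neg_less_0_iff_less mult_less_0_iff
        not_less_iff_gr_or_eq less_le_trans zero_less_one)
  obtain \<Gamma>' where \<Gamma>': "ssr_graph \<Gamma>'" "\<And>l. quasi_linear \<Gamma>' l \<ge> 0 \<longleftrightarrow> quasi_linear \<Gamma> l \<ge> 0"
    using exists_ssr_graph[of ls "int k * b"] euler p_pos xs(2)
    unfolding \<Gamma>_def by (fastforce simp: ls_def)
  have mem: "k * l \<in> generated_submonoid (insert P (a ` I)) \<longleftrightarrow> quasi_linear \<Gamma>' (int l) \<ge> 0" for l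
    unfolding \<Gamma>'(2) quasi using k c by (rule mult_mem_generated_iff)
  have "int ` semigroup_quotient (generated_submonoid (insert P (a ` I))) k = ssr_semigroup \<Gamma>'"
    unfolding semigroup_quotient_def ssr_semigroup_def mem
  proof (intro equalityI subsetI)
    fix l assume "l \<in> {l. quasi_linear \<Gamma>' l \<ge> 0}"
    moreover from this have "l \<ge> 0"
      using quasi_linear_neg[OF euler, of l] \<Gamma>'(2) by (meson linorder_not_le mem_Collect_eq)
    ultimately show "l \<in> int ` {l. quasi_linear \<Gamma>' (int l) \<ge> 0}"
      by (intro image_eqI[of _ _ "nat l"]) auto
  qed auto
  with \<Gamma>'(1) show ?thesis
    by blast
qed

text \<open>A generator with \<open>s_hat\<close> equal to 1 is the product \<open>P\<close> of the
  numbers \<open>q A b\<close> of the others. The others form a coprime system indexed by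
  themselves.\<close>

lemma flat_set_generated_quotient:
  assumes flat: "flat_set A" and k: "k \<ge> 1"
  shows "\<exists>\<Gamma>. ssr_graph \<Gamma> \<and>
    int ` semigroup_quotient (generated_submonoid A) k = ssr_semigroup \<Gamma>"
proof -
  obtain a where A: "finite A" "Gcd A = 1" and a: "a \<in> A" "s_hat A a = 1"
    using flat by (auto simp: flat_set_def)
  define I where "I = A - {a}"
  have a_pos: "a > 0"
    using a(2) by (auto simp: s_hat_def intro: gr0I)
  have q_dvd: "q A b dvd c" if "c \<in> A" "c \<noteq> b" for b c
    using that by (auto simp: q_def)
  \<comment> \<open>Every element of \<open>A\<close> differs from \<open>b\<close> or from
    \<open>c\<close>, so a common divisor divides all of \<open>A\<close>.\<close>
  have coprime_q: "coprime (q A b) (q A c)" if "b \<noteq> c" for b c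
  proof (rule coprimeI)
    fix d assume "d dvd q A b" "d dvd q A c"
    then have "d dvd x" if "x \<in> A" for x
      using that q_dvd \<open>b \<noteq> c\<close> by (metis dvd_trans)
    then have "d dvd Gcd A"
      by (rule Gcd_greatest)
    then show "is_unit d"
      by (simp add: A)
  qed
  have "coprime b (q A b)" if "b \<in> A" for b
  proof (rule coprimeI)
    fix d assume "d dvd b" "d dvd q A b"
    then have "d dvd x" if "x \<in> A" for x
      using that q_dvd by (metis dvd_trans)
    then have "d dvd Gcd A"
      by (rule Gcd_greatest)
    then show "is_unit d"
      by (simp add: A)
  qed
  then have "\<forall>b\<in>A. \<exists>x. [b * x = 1] (mod q A b)"
    by (metis One_nat_def cong_solve_coprime_nat)
  then obtain u where u: "\<And>b. b \<in> A \<Longrightarrow> [b * u b = 1] (mod q A b)"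
    by metis
  have q_pos: "q A b > 0" if "b \<in> I" for b
    using q_dvd[of a b] a that a_pos unfolding I_def by (metis DiffD2 dvd_0_left_iff gr0I insertI1)
  interpret coprime_system I "q A" id u
    using A u q_dvd coprime_q q_pos by unfold_locales (auto simp: I_def)
  have "P dvd a"
    unfolding P_def using a finite_I coprime_q q_dvd
    by (intro prod_dvd_of_pairwise_coprime) (auto simp: I_def)
  moreover have "a div P = 1"
    using a(2) by (simp add: s_hat_def q_hat_def P_def flip: I_def)
  ultimately have "P = a"
    by (metis dvd_mult_div_cancel mult.right_neutral)
  then have "insert P (id ` I) = A"
    using a by (auto simp: I_def)
  then show ?thesis
    using generated_quotient_eq_ssr_semigroup[OF k] by simp
qed

section \<open>Representable semigroups are quotients of flat semigroups\<close>

text \<open>A prime dividing all products divides some \<open>p j\<close>. As it also divides the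
  product omitting \<open>p j\<close>, it divides a second factor, against coprimality.\<close>

lemma Gcd_coprime_products:
  fixes p :: "'i \<Rightarrow> nat"
  assumes "finite I" "I \<noteq> {}"
    and coprime_p: "\<And>i j. i \<in> I \<Longrightarrow> j \<in> I \<Longrightarrow> i \<noteq> j \<Longrightarrow> coprime (p i) (p j)"
  shows "Gcd ((\<lambda>i. \<Prod>j\<in>I - {i}. p j) ` I) = 1"
proof (rule ccontr)
  define a where "a i = (\<Prod>j\<in>I - {i}. p j)" for i
  assume "Gcd ((\<lambda>i. \<Prod>j\<in>I - {i}. p j) ` I) \<noteq> 1"
  then obtain r where r: "prime r" "r dvd Gcd (a ` I)"
    unfolding a_def by (metis prime_factor_nat)
  have factor: "\<exists>j\<in>I - {i}. r dvd p j" if "i \<in> I" for i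
  proof -
    have "r dvd a i"
      using r(2) that by (meson Gcd_dvd dvd_trans imageI)
    then show ?thesis
      using r(1) assms(1) by (simp add: a_def prime_dvd_prod_iff)
  qed
  obtain j where j: "j \<in> I" "r dvd p j"
    using factor assms(2) by blast
  obtain j' where "j' \<in> I" "j' \<noteq> j" "r dvd p j'"
    using factor[OF j(1)] by blast
  with j have "r dvd 1"
    using coprime_p by (metis coprime_def)
  with r(1) show False
    by simp
qed

text \<open>The number \<open>q\<close> belonging to the product that omits \<open>p i\<close> is
  \<open>p i\<close>, so \<open>q_hat\<close> gives back that product and \<open>s_hat\<close> is
  1.\<close>

lemma flat_semigroup_coprime_products:
  fixes p :: "'i \<Rightarrow> nat"
  assumes "finite I" "I \<noteq> {}"
    and coprime_p: "\<And>i j. i \<in> I \<Longrightarrow> j \<in> I \<Longrightarrow> i \<noteq> j \<Longrightarrow> coprime (p i) (p j)"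
    and p_gt_1: "\<And>i. i \<in> I \<Longrightarrow> p i > 1"
    and fin: "finite (- generated_submonoid ((\<lambda>i. \<Prod>j\<in>I - {i}. p j) ` I))"
  shows "flat_semigroup (generated_submonoid ((\<lambda>i. \<Prod>j\<in>I - {i}. p j) ` I))"
proof -
  define a where "a i = (\<Prod>j\<in>I - {i}. p j)" for i
  have p_dvd_a: "p i dvd a j" if "i \<in> I" "j \<in> I" "i \<noteq> j" for i j
    unfolding a_def using that assms(1) by (intro dvd_prodI) auto
  have p_not_dvd_a: "\<not> p i dvd a i" if "i \<in> I" for i
  proof -
    have "coprime (p i) (a i)"
      unfolding a_def using that coprime_p by (intro prod_coprime_right) auto
    then show ?thesis
      using p_gt_1[OF that] by (metis coprime_absorb_left is_unit_gcd nat_dvd_1_iff_1 nat_neq_iff)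
  qed
  have inj_a: "inj_on a I"
    using p_dvd_a p_not_dvd_a by (metis inj_onI)
  \<comment> \<open>The other generators share the factor \<open>p i\<close>, and the cofactors are
    the products of the family without \<open>i\<close>. For a singleton \<open>I\<close> the gcd
    would be that of the empty set, which is 0.\<close>
  have q: "q (a ` I) (a i) = p i" if i: "i \<in> I" "I - {i} \<noteq> {}" for i
  proof -
    have "a ` I - {a i} = a ` (I - {i})"
      using inj_a i by (auto simp: inj_on_def)
    also have "\<dots> = (*) (p i) ` (\<lambda>j. \<Prod>l\<in>I - {i} - {j}. p l) ` (I - {i})"
      unfolding image_image
    proof (rule image_cong[OF refl])
      fix j assume "j \<in> I - {i}"
      then have "i \<in> I - {j}" "I - {j} - {i} = I - {i} - {j}"
        using i by auto
      then show "a j = p i * (\<Prod>l\<in>I - {i} - {j}. p l)"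
        unfolding a_def using assms(1) by (simp add: prod.remove)
    qed
    finally have "q (a ` I) (a i) = p i * Gcd ((\<lambda>j. \<Prod>l\<in>I - {i} - {j}. p l) ` (I - {i}))"
      unfolding q_def by (simp add: Gcd_mult)
    also have "Gcd ((\<lambda>j. \<Prod>l\<in>I - {i} - {j}. p l) ` (I - {i})) = 1"
      using assms(1) i coprime_p by (intro Gcd_coprime_products) auto
    finally show ?thesis
      by simp
  qed
  obtain i where i: "i \<in> I"
    using assms(2) by blast
  have "q_hat (a ` I) (a i) = (\<Prod>b\<in>a ` (I - {i}). q (a ` I) b)"
    unfolding q_hat_def using inj_a i by (intro prod.cong) (auto simp: inj_on_def)
  also have "\<dots> = (\<Prod>j\<in>I - {i}. q (a ` I) (a j))"
    using inj_a by (subst prod.reindex) (auto simp: inj_on_diff)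
  also have "\<dots> = a i"
    unfolding a_def[of i] using q i by (intro prod.cong) auto
  finally have "s_hat (a ` I) (a i) = 1"
    using p_not_dvd_a[OF i] unfolding s_hat_def by (metis div_self dvd_0_right)
  then have "flat_set (a ` I)"
    using i assms(1) Gcd_coprime_products[OF assms(1,2) coprime_p]
    by (auto simp: flat_set_def a_def)
  \<comment> \<open>Minimality: without \<open>a i\<close>, only multiples of \<open>p i\<close> are
    generated.\<close>
  moreover have "generated_submonoid B \<noteq> generated_submonoid (a ` I)" if B: "B \<subset> a ` I" for B
  proof -
    obtain i where i: "i \<in> I" "a i \<notin> B"
      using B by blast
    have "B \<subseteq> {x. p i dvd x}"
    proof
      fix x assume "x \<in> B"
      then obtain j where "j \<in> I" "x = a j"
        using B by blast
      then show "x \<in> {x. p i dvd x}"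
        using \<open>x \<in> B\<close> i p_dvd_a[of i j] by auto
    qed
    then have "generated_submonoid B \<subseteq> {x. p i dvd x}"
      by (rule generated_submonoid_minimal) (simp add: submonoid_nat_def)
    then show ?thesis
      using generated_submonoid_incl[of "a i" "a ` I"] p_not_dvd_a[OF i(1)] i(1) by blast
  qed
  ultimately show ?thesis
    using fin submonoid_generated_submonoid
    unfolding flat_semigroup_def numerical_semigroup_def minimal_generators_def a_def by blast
qed

section \<open>Replacing the slopes by fractions with prime denominators\<close>

text \<open>Here w/p is the largest fraction with denominator p strictly below \<omega> / \<alpha>,
  so it is off by at most 1/p. After multiplication by l \<le> m the error is less than 1/\<alpha>,
  too small to reach the next lower integer.\<close>

lemma ceiling_eq_of_slightly_smaller:
  fixes \<alpha> \<omega> p w l m :: int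
  assumes "\<alpha> > 0" "p > m * \<alpha>" "p > 0" "0 < l" "l \<le> m" and w: "w = (p * \<omega> - 1) div \<alpha>"
  shows "\<lceil>of_int (l * w) / (of_int p :: rat)\<rceil> = \<lceil>of_int (l * \<omega>) / (of_int \<alpha> :: rat)\<rceil>"
proof -
  define c where "c = \<lceil>of_int (l * \<omega>) / (of_int \<alpha> :: rat)\<rceil>"
  have w_bounds: "\<alpha> * w < p * \<omega>" "p * \<omega> \<le> \<alpha> * w + \<alpha>"
    using assms(1) pos_mod_sign[of \<alpha> "p * \<omega> - 1"] pos_mod_bound[of \<alpha> "p * \<omega> - 1"]
      mult_div_mod_eq[of \<alpha> "p * \<omega> - 1"] unfolding w by linarith+
  define v where "v = - (l * \<omega>)"
  have "c = - (v div \<alpha>)"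
    unfolding c_def v_def by (rule ceiling_of_int_divide)
  then have c_\<alpha>: "c * \<alpha> = v mod \<alpha> - v"
    by (simp flip: minus_div_mult_eq_mod)
  \<comment> \<open>The \<open>+ 1\<close> comes from integrality and gives the margin 1/\<alpha>
    above c - 1.\<close>
  have c_bounds: "(c - 1) * \<alpha> + 1 \<le> l * \<omega>" "l * \<omega> \<le> c * \<alpha>"
    using c_\<alpha> v_def pos_mod_sign[OF assms(1), of v] pos_mod_bound[OF assms(1), of v]
    unfolding left_diff_distrib by linarith+
  have "\<alpha> * (l * w) \<le> \<alpha> * (p * c)"
  proof -
    have "\<alpha> * (l * w) \<le> l * (p * \<omega>)"
      using mult_left_mono[of "\<alpha> * w" "p * \<omega>" l] assms w_bounds by (simp add: mult_ac)
    also have "\<dots> = p * (l * \<omega>)"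
      by simp
    also have "\<dots> \<le> p * (c * \<alpha>)"
      using assms c_bounds by (intro mult_left_mono) auto
    finally show ?thesis
      by (simp add: mult_ac)
  qed
  moreover have "\<alpha> * (p * (c - 1)) < \<alpha> * (l * w)"
  proof -
    have "l * \<alpha> \<le> m * \<alpha>"
      using assms by (intro mult_right_mono) auto
    have "\<alpha> * (p * (c - 1)) + p = p * ((c - 1) * \<alpha> + 1)"
      by (simp add: algebra_simps)
    also have "\<dots> \<le> p * (l * \<omega>)"
      using assms c_bounds by (intro mult_left_mono) auto
    also have "\<dots> \<le> l * (\<alpha> * w + \<alpha>)"
      using mult_left_mono[OF w_bounds(2), of l] assms by (simp add: mult_ac)
    finally show ?thesis
      using \<open>l * \<alpha> \<le> m * \<alpha>\<close> assms(2) by (simp add: algebra_simps)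
  qed
  ultimately have "l * w \<le> p * c" "p * (c - 1) < l * w"
    using assms(1) by (auto simp: mult_less_cancel_left)
  then have "of_int (l * w) \<le> (of_int (p * c) :: rat)" "of_int (p * (c - 1)) < (of_int (l * w) :: rat)"
    by (simp_all only: of_int_le_iff of_int_less_iff)
  then have "\<lceil>of_int (l * w) / (of_int p :: rat)\<rceil> = c"
    using assms(3) by (simp add: ceiling_eq_iff pos_less_divide_eq pos_divide_le_eq mult.commute)
  then show ?thesis
    by (simp add: c_def)
qed

lemma exists_distinct_large_primes:
  "\<exists>p :: nat \<Rightarrow> nat. inj p \<and> (\<forall>i. prime (p i) \<and> p i > m)"
proof -
  have "infinite ({p :: nat. prime p} - {..m})"
    using primes_infinite by simp
  then obtain p :: "nat \<Rightarrow> nat" where "inj p" "range p \<subseteq> {p. prime p} - {..m}"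
    using infinite_countable_subset by blast
  then show ?thesis
    by (intro exI[of _ p]) (auto simp: image_subset_iff not_le)
qed

text \<open>Once the denominators are distinct primes, \<open>a i\<close> can be taken as P / p_i,
  so each leg occurs once (\<open>c i = 1\<close>).\<close>

lemma flat_quotient_eq_ssr_semigroup:
  assumes \<Gamma>: "ssr_graph \<Gamma>"
  shows "\<exists>F k. flat_semigroup F \<and> k \<ge> 1 \<and>
    (\<forall>l. k * l \<in> F \<longleftrightarrow> quasi_linear \<Gamma> (int l) \<ge> 0)"
proof -
  define d where "d = length (legs \<Gamma>)"
  define \<alpha> \<omega> where "\<alpha> i = fst (legs \<Gamma> ! i)" and "\<omega> i = snd (legs \<Gamma> ! i)" for i
  define b where "b = minus_central \<Gamma>"
  have d: "d \<ge> 3" and euler_neg: "euler_number \<Gamma> < 0"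
    using \<Gamma> by (auto simp: ssr_graph_def d_def)
  have \<alpha>_pos: "\<alpha> i > 0" if "i < d" for i
  proof -
    have "legs \<Gamma> ! i \<in> set (legs \<Gamma>)"
      using that by (simp add: d_def)
    then show ?thesis
      using \<Gamma> by (force simp: ssr_graph_def \<alpha>_def)
  qed
  have \<Gamma>_eq: "\<Gamma> = Seifert b (map (\<lambda>i. (\<alpha> i, \<omega> i)) [0..<d])"
    by (cases \<Gamma>) (simp add: b_def \<alpha>_def \<omega>_def d_def map_nth)
  have sum_legs: "(\<Sum>(x, y)\<leftarrow>map (\<lambda>i. (f i, g i)) [0..<d]. h x y) = (\<Sum>i<d. h (f i) (g i))"
    for f g :: "nat \<Rightarrow> int" and h :: "int \<Rightarrow> int \<Rightarrow> 'x :: comm_monoid_add"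
    by (simp add: interv_sum_list_conv_sum_set_nat o_def atLeast0LessThan)

  \<comment> \<open>beyond \<open>m\<close> the linear part of the quasi-linear function dominates the rounding errors\<close>
  define m where "m = nat \<lceil>of_nat d / - euler_number \<Gamma>\<rceil>"
  obtain p :: "nat \<Rightarrow> nat" where p: "inj p" "\<And>i. prime (p i)"
    "\<And>i. p i > nat (int m * (\<Sum>j<d. \<alpha> j))"
    using exists_distinct_large_primes by metis
  have p_large: "int (p i) > int m * \<alpha> i" if "i < d" for i
  proof -
    have "\<alpha> i \<le> (\<Sum>j<d. \<alpha> j)"
      using that \<alpha>_pos by (intro member_le_sum) (auto intro: less_imp_le)
    then have "int m * \<alpha> i \<le> int m * (\<Sum>j<d. \<alpha> j)"
      by (intro mult_left_mono) auto
    also have "\<dots> < int (p i)"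
      using p(3)[of i] by linarith
    finally show ?thesis .
  qed
  have p_pos: "p i > 0" for i
    using p(2) by (rule prime_gt_0_nat)
  have coprime_p: "coprime (p i) (p j)" if "i \<noteq> j" for i j
    using that p(1,2) by (metis injD primes_coprime)
  define w where "w i = (int (p i) * \<omega> i - 1) div \<alpha> i" for i
  define \<Gamma>' where "\<Gamma>' = Seifert b (map (\<lambda>i. (int (p i), w i)) [0..<d])"

  \<comment> \<open>Lower slopes give a smaller Euler number. Thus the bound \<open>m\<close> also
    serves the new data, and \<open>k\<close> below is positive.\<close>
  have "(\<Sum>i<d. of_int (w i) / of_int (int (p i))) \<le> (\<Sum>i<d. of_int (\<omega> i) / of_int (\<alpha> i) :: rat)"
  proof (rule sum_mono)
    fix i assume "i \<in> {..<d}"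
    then have \<alpha>: "\<alpha> i > 0"
      using \<alpha>_pos by simp
    have "w i * \<alpha> i \<le> int (p i) * \<omega> i"
      using pos_mod_sign[OF \<alpha>] div_mult_mod_eq[of "int (p i) * \<omega> i - 1" "\<alpha> i"]
      unfolding w_def by (smt (verit))
    then have "of_int (w i * \<alpha> i) \<le> (of_int (int (p i) * \<omega> i) :: rat)"
      by (simp only: of_int_le_iff)
    then show "of_int (w i) / of_int (int (p i)) \<le> (of_int (\<omega> i) / of_int (\<alpha> i) :: rat)"
      using \<alpha> p_pos[of i] by (simp add: field_simps)
  qed
  then have euler_le: "euler_number \<Gamma>' \<le> euler_number \<Gamma>"
    unfolding \<Gamma>'_def \<Gamma>_eq euler_number_def by (simp add: sum_legs del: map_map)

  \<comment> \<open>Up to \<open>m\<close> the two functions agree; beyond \<open>m\<close> both are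
    nonnegative.\<close>
  have same_sign: "quasi_linear \<Gamma>' (int l) \<ge> 0 \<longleftrightarrow> quasi_linear \<Gamma> (int l) \<ge> 0" for l
  proof (cases "l \<le> m")
    case True
    have "\<lceil>of_int (int l * w i) / (of_int (int (p i)) :: rat)\<rceil> =
        \<lceil>of_int (int l * \<omega> i) / (of_int (\<alpha> i) :: rat)\<rceil>" if i: "i < d" for i
    proof (cases "l = 0")
      case False
      then show ?thesis
        using True p_large[OF i] \<alpha>_pos[OF i] p_pos[of i]
        by (intro ceiling_eq_of_slightly_smaller[where m = "int m"]) (auto simp: w_def)
    qed simp
    then have "quasi_linear \<Gamma>' (int l) = quasi_linear \<Gamma> (int l)"
      unfolding \<Gamma>'_def \<Gamma>_eq quasi_linear_def
      by (simp add: sum_legs del: map_map of_int_mult)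
    then show ?thesis
      by simp
  next
    case False
    have "quasi_linear G (int l) \<ge> 0" if G: "euler_number G \<le> euler_number \<Gamma>" "length (legs G) = d" for G
    proof -
      have "of_nat d / - euler_number \<Gamma> \<le> of_nat l"
        using False unfolding m_def by linarith
      then have "of_nat d \<le> of_nat l * (- euler_number \<Gamma>)"
        using euler_neg by (subst (asm) pos_divide_le_eq) auto
      also have "\<dots> \<le> of_nat l * (- euler_number G)"
        using G by (intro mult_left_mono) auto
      finally have "(0 :: rat) \<le> of_int (quasi_linear G (int l))"
        using quasi_linear_ge[of "int l" G] G(2) by simp
      then show ?thesis
        by simp
    qed
    from this[of \<Gamma>] this[of \<Gamma>'] show ?thesis
      using euler_le by (simp add: d_def \<Gamma>'_def)
  qed

  define a where "a i = (\<Prod>j\<in>{..<d} - {i}. p j)" for i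
  have "coprime (a i) (p i)" for i
    unfolding a_def using coprime_p by (intro prod_coprime_left) auto
  then have "\<forall>i. \<exists>x. [a i * x = 1] (mod p i)"
    by (metis One_nat_def cong_solve_coprime_nat)
  then obtain u where u: "\<And>i. [a i * u i = 1] (mod p i)"
    by metis
  interpret coprime_system "{..<d}" p a u
    using u coprime_p p_pos by unfold_locales (auto simp: a_def)
  have P: "a i * p i = P" if "i < d" for i
    using that by (simp add: P_def a_def prod.remove[of "{..<d}" i])
  have "P \<in> generated_submonoid (a ` {..<d})"
    using P[of 0] d by (metis generated_submonoid_incl submonoid_generated_submonoid
      submonoid_nat_mult imageI lessThan_iff mult.commute less_le_trans zero_less_numeral)
  then have F_eq: "generated_submonoid (insert P (a ` {..<d})) = generated_submonoid (a ` {..<d})"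
    by (rule generated_submonoid_insert)
  have flat: "flat_semigroup (generated_submonoid (a ` {..<d}))"
    using d coprime_p p(2) prime_gt_1_nat finite_compl_generated
    unfolding F_eq unfolding a_def
    by (intro flat_semigroup_coprime_products) (auto simp: lessThan_empty_iff)

  \<comment> \<open>The integer inside \<open>nat\<close> is \<open>P\<close> times minus the Euler
    number of \<open>\<Gamma>'\<close>, hence positive.\<close>
  define k where "k = nat (b * int P - (\<Sum>i<d. int (a i) * w i))"
  have "of_int (b * int P - (\<Sum>i<d. int (a i) * w i)) = of_nat P * (- euler_number \<Gamma>')"
  proof -
    have "of_int (int (a i) * w i) = (of_nat P * (of_int (w i) / of_int (int (p i))) :: rat)"
      if "i < d" for i
      using P[OF that, symmetric] p_pos[of i] that by simp
    moreover have "of_int (b * int P) = (of_nat P * of_int b :: rat)"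
      by simp
    ultimately show ?thesis
      unfolding \<Gamma>'_def euler_number_def
      by (simp add: sum_legs sum_distrib_left right_diff_distrib del: map_map of_int_mult)
  qed
  also have "\<dots> > 0"
    using P_pos euler_le euler_neg by (intro mult_pos_pos) auto
  finally have "b * int P - (\<Sum>i<d. int (a i) * w i) > 0"
    by (simp only: of_int_0_less_iff)
  then have k: "int k = b * int P - (\<Sum>i<d. int (a i) * w i)" "k \<ge> 1"
    by (auto simp: k_def)
  have "k * l \<in> generated_submonoid (a ` {..<d}) \<longleftrightarrow> quasi_linear \<Gamma> (int l) \<ge> 0" for l
    using mult_mem_generated_iff[OF k(1), of "\<lambda>_. 1" l] P
    unfolding F_eq same_sign[symmetric] unfolding \<Gamma>'_def quasi_linear_def
    by (simp add: sum_legs del: map_map of_int_mult)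
  with flat k(2) show ?thesis
    by blast
qed

theorem mainTheorem1:
  fixes S :: "nat set"
  assumes "numerical_semigroup S"
  shows "representable S \<longleftrightarrow>
    (\<exists>F k. flat_semigroup F \<and> k \<ge> 1 \<and> S = semigroup_quotient F k)"
proof
  assume "representable S"
  then obtain \<Gamma> where \<Gamma>: "ssr_graph \<Gamma>" "int ` S = ssr_semigroup \<Gamma>"
    by (auto simp: representable_def)
  then obtain F k where "flat_semigroup F" "k \<ge> 1"
    "\<And>l. k * l \<in> F \<longleftrightarrow> quasi_linear \<Gamma> (int l) \<ge> 0"
    using flat_quotient_eq_ssr_semigroup by metis
  moreover have "l \<in> S \<longleftrightarrow> quasi_linear \<Gamma> (int l) \<ge> 0" for l
    using \<Gamma>(2) unfolding ssr_semigroup_def by (metis image_iff mem_Collect_eq of_nat_eq_iff)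
  ultimately show "\<exists>F k. flat_semigroup F \<and> k \<ge> 1 \<and> S = semigroup_quotient F k"
    unfolding semigroup_quotient_def by blast
next
  assume "\<exists>F k. flat_semigroup F \<and> k \<ge> 1 \<and> S = semigroup_quotient F k"
  then obtain F k where F: "flat_semigroup F" and k: "k \<ge> 1" and S: "S = semigroup_quotient F k"
    by blast
  \<comment> \<open>The case \<open>F = UNIV\<close> is covered by the set \<open>{1}\<close>, for
    which \<open>q_hat\<close> is an empty product.\<close>
  have "\<exists>A. flat_set A \<and> generated_submonoid A = F"
  proof (cases "F = UNIV")
    case True
    have "flat_set {1}"
      by (simp add: flat_set_def s_hat_def q_hat_def)
    moreover have "n \<in> generated_submonoid {1}" for n
      using submonoid_nat_mult[OF submonoid_generated_submonoid generated_submonoid_incl, of 1 "{1}" n]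
      by simp
    ultimately show ?thesis
      using True by blast
  next
    case False
    then show ?thesis
      using F by (auto simp: flat_semigroup_def minimal_generators_def)
  qed
  then show "representable S"
    using flat_set_generated_quotient[OF _ k] assms unfolding representable_def S by metis
qed

end
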